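(* Consider the optimization problem $$\min_{\boldsymbol{\kappa},\boldsymbol{g}}\ \mathrm{P}_e(\boldsymbol{\kappa},\boldsymbol{g})\quad\text{s.t.}\quad \mathcal{C}(\boldsymbol{\kappa},\boldsymbol{g})\le\bar{\mathcal{C}},\ \ \boldsymbol{\kappa}\in\mathbb{R}_{\ge 0}^n,\ \ \boldsymbol{g}\in\mathbb{R}_{\ge 0}^n,$$ with $\mathrm{P}_e$ and $\mathcal{C}$ as defined in the context. Let $$\rho_i=\frac{\gamma_i^2|h_i|^2}{\left(\tilde\sigma_v\sqrt{\xi_i}+|h_i|\sqrt{c_0}\right)^2},\qquad i=1,\dots,n,$$ and assume $\rho_1\ge\rho_2\ge\cdots\ge\rho_n$. Then the optimal solution of $(\boldsymbol{\kappa},\boldsymbol{g})$ is $$\kappa_i=\begin{cases}\dfrac{|h_i|\,\bar{\mathcal{C}}}{\tilde\sigma_v\sqrt{\xi_ic_0}+|h_i|c_0}, & i=1,\\[2mm] 0, & i>1,\end{cases}\qquad g_i=\begin{cases}\left(\dfrac{\tilde\sigma_v\,\bar{\mathcal{C}}}{\tilde\sigma_v\,\xi_i+|h_i|\sqrt{\xi_ic_0}}\right)^{1/2}, & i=1,\\[2mm] 0, & i>1.\end{cases}$$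
   Context: Let $n\ge1$ be the number of secondary users. For each $i\in\{1,\dots,n\}$, $\gamma_i>0$ is the local received SNR and $h_i\in\mathbb{C}\setminus\{0\}$ the fusion channel gain. Let $\sigma_n^2,\sigma_v^2>0$ be noise variances, $\tilde\sigma_v^2=\sigma_v^2/\sigma_n^4$ with $\tilde\sigma_v>0$, let $c_0>0$ be the processing cost per sample and $\bar{\mathcal{C}}>0$ the system level cost constraint. Put $\xi_i=(1+2\pi_1\gamma_i)\sigma_n^4>0$, where $\pi_1=1/2$ is the probability that the spectrum is occupied; the $\xi_i$ are constants, independent of $(\boldsymbol{\kappa},\boldsymbol{g})$. For $\boldsymbol{\kappa}=(\kappa_1,\dots,\kappa_n)$ (numbers of samples, relaxed to be real) and $\boldsymbol{g}=(g_1,\dots,g_n)$ (amplifier gains) with nonnegative entries, define the error probability $$\mathrm{P}_e(\boldsymbol{\kappa},\boldsymbol{g})=Q\left(\frac12\Big(\sum_{i=1}^n\frac{g_i^2\kappa_i\gamma_i^2|h_i|^2}{g_i^2|h_i|^2+\kappa_i\tilde\sigma_v^2}\Big)^{1/2}\right),\qquad Q(x)=\frac1{\sqrt{2\pi}}\int_x^\infty e^{-t^2/2}\,dt,$$ where the $i$-th summand is taken to be $0$ when $\kappa_i=g_i=0$, and the system level cost $$\mathcal{C}(\boldsymbol{\kappa},\boldsymbol{g})=\sum_{i=1}^n\left(c_0\kappa_i+\xi_ig_i^2\right).$$ *)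

theory Defs
  imports "HOL-Analysis.Analysis"
begin

text \<open>
  Vectors in \<open>\<real>\<^sup>n\<close> are extensional functions on the index set \<open>{1..n}\<close>, so that two of them are
  equal as functions iff their \<open>n\<close> entries agree. Parameters indexed by the users are plain
  functions, used on \<open>{1..n}\<close> only.
\<close>

definition nonneg_vecs :: "nat \<Rightarrow> (nat \<Rightarrow> real) set" where
  "nonneg_vecs n = {1..n} \<rightarrow>\<^sub>E {0..}"

definition Q_fun :: "real \<Rightarrow> real" where
  "Q_fun x = 1 / sqrt (2 * pi) * (LBINT t:{x..}. exp (- (t ^ 2) / 2))"

text \<open>\<open>\<sigma>n\<close> and \<open>\<sigma>v\<close> are standard deviations; the noise variances are their squares.\<close>

definition sigma_tilde :: "real \<Rightarrow> real \<Rightarrow> real" where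
  "sigma_tilde \<sigma>n \<sigma>v = sqrt (\<sigma>v ^ 2 / \<sigma>n ^ 4)"

text \<open>Probability that the spectrum is occupied.\<close>

definition pi_one :: real where
  "pi_one = 1 / 2"

definition xi :: "real \<Rightarrow> (nat \<Rightarrow> real) \<Rightarrow> nat \<Rightarrow> real" where
  "xi \<sigma>n \<gamma> i = (1 + 2 * pi_one * \<gamma> i) * \<sigma>n ^ 4"

text \<open>
  The summand for \<open>\<kappa> i = g i = 0\<close> is \<open>0 / 0 = 0\<close>, which is the intended value. For all other
  nonnegative \<open>\<kappa> i\<close>, \<open>g i\<close> the denominator is positive (given \<open>h i \<noteq> 0\<close> and nonzero noise).
\<close>

definition error_prob ::
  "nat \<Rightarrow> (nat \<Rightarrow> real) \<Rightarrow> (nat \<Rightarrow> complex) \<Rightarrow> real \<Rightarrow> real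
    \<Rightarrow> (nat \<Rightarrow> real) \<Rightarrow> (nat \<Rightarrow> real) \<Rightarrow> real" where
  "error_prob n \<gamma> h \<sigma>n \<sigma>v \<kappa> g =
     Q_fun (1 / 2 * sqrt (\<Sum>i = 1..n.
       (g i ^ 2 * \<kappa> i * \<gamma> i ^ 2 * cmod (h i) ^ 2) /
       (g i ^ 2 * cmod (h i) ^ 2 + \<kappa> i * sigma_tilde \<sigma>n \<sigma>v ^ 2)))"

definition system_cost ::
  "nat \<Rightarrow> (nat \<Rightarrow> real) \<Rightarrow> real \<Rightarrow> real \<Rightarrow> (nat \<Rightarrow> real) \<Rightarrow> (nat \<Rightarrow> real) \<Rightarrow> real" where
  "system_cost n \<gamma> \<sigma>n c0 \<kappa> g = (\<Sum>i = 1..n. c0 * \<kappa> i + xi \<sigma>n \<gamma> i * g i ^ 2)"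

definition feasible ::
  "nat \<Rightarrow> (nat \<Rightarrow> real) \<Rightarrow> real \<Rightarrow> real \<Rightarrow> real \<Rightarrow> (nat \<Rightarrow> real) \<times> (nat \<Rightarrow> real) \<Rightarrow> bool" where
  "feasible n \<gamma> \<sigma>n c0 Cbar = (\<lambda>(\<kappa>, g).
     system_cost n \<gamma> \<sigma>n c0 \<kappa> g \<le> Cbar \<and> \<kappa> \<in> nonneg_vecs n \<and> g \<in> nonneg_vecs n)"

definition optimal_solution ::
  "nat \<Rightarrow> (nat \<Rightarrow> real) \<Rightarrow> (nat \<Rightarrow> complex) \<Rightarrow> real \<Rightarrow> real \<Rightarrow> real \<Rightarrow> real
    \<Rightarrow> (nat \<Rightarrow> real) \<times> (nat \<Rightarrow> real) \<Rightarrow> bool" where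
  "optimal_solution n \<gamma> h \<sigma>n \<sigma>v c0 Cbar =
     is_arg_min (\<lambda>(\<kappa>, g). error_prob n \<gamma> h \<sigma>n \<sigma>v \<kappa> g) (feasible n \<gamma> \<sigma>n c0 Cbar)"

definition rho ::
  "(nat \<Rightarrow> real) \<Rightarrow> (nat \<Rightarrow> complex) \<Rightarrow> real \<Rightarrow> real \<Rightarrow> real \<Rightarrow> nat \<Rightarrow> real" where
  "rho \<gamma> h \<sigma>n \<sigma>v c0 i =
     (\<gamma> i ^ 2 * cmod (h i) ^ 2) /
     (sigma_tilde \<sigma>n \<sigma>v * sqrt (xi \<sigma>n \<gamma> i) + cmod (h i) * sqrt c0) ^ 2"

definition kappa_opt ::
  "nat \<Rightarrow> (nat \<Rightarrow> real) \<Rightarrow> (nat \<Rightarrow> complex) \<Rightarrow> real \<Rightarrow> real \<Rightarrow> real \<Rightarrow> real \<Rightarrow> nat \<Rightarrow> real" where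
  "kappa_opt n \<gamma> h \<sigma>n \<sigma>v c0 Cbar = (\<lambda>i\<in>{1..n}.
     if i = 1 then
       cmod (h i) * Cbar /
       (sigma_tilde \<sigma>n \<sigma>v * sqrt (xi \<sigma>n \<gamma> i * c0) + cmod (h i) * c0)
     else 0)"

definition gain_opt ::
  "nat \<Rightarrow> (nat \<Rightarrow> real) \<Rightarrow> (nat \<Rightarrow> complex) \<Rightarrow> real \<Rightarrow> real \<Rightarrow> real \<Rightarrow> real \<Rightarrow> nat \<Rightarrow> real" where
  "gain_opt n \<gamma> h \<sigma>n \<sigma>v c0 Cbar = (\<lambda>i\<in>{1..n}.
     if i = 1 then
       sqrt (sigma_tilde \<sigma>n \<sigma>v * Cbar /
         (sigma_tilde \<sigma>n \<sigma>v * xi \<sigma>n \<gamma> i + cmod (h i) * sqrt (xi \<sigma>n \<gamma> i * c0)))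
     else 0)"

end

(*
  Write p = sqrt(xi), q = sqrt(c0), a = |h|, s = sigma_tilde and x = g^2. Then
    (x a^2 + k s^2)(q^2 k + p^2 x) - (s p + a q)^2 x k = (p a x - q s k)^2 >= 0,
  so the contribution of each user to the sum under the square root is at most rho_i times the
  cost spent on that user, with equality iff p a x = q s k. Hence the sum is at most
  rho_1 times the total budget, which is attained by spending everything on user 1 and balancing
  p a x = q s k. As Q is strictly decreasing, this minimises the error probability, and the
  equality cases give uniqueness when rho_1 is the unique maximum.
*)
theory Submission
  imports Defs "HOL-Probability.Distributions"
begin

text \<open>The two tails differ by the integral over \<open>{x..<y}\<close>, which is positive
  because the integrand has a positive lower bound on this interval.\<close>

lemma Q_fun_strict_antimono:
  assumes "x < y"
  shows "Q_fun y < Q_fun x"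
proof -
  let ?f = "\<lambda>t::real. exp (- (t ^ 2) / 2)"
  have "integrable lborel (\<lambda>t. sqrt (2 * pi) * std_normal_density t)"
    using integrable_normal_density[of 1 0] by simp
  then have int: "integrable lborel ?f"
    by (simp add: std_normal_density_def)
  have si: "set_integrable lborel A ?f" if "A \<in> sets lborel" for A
    unfolding set_integrable_def using integrable_mult_indicator[OF that int] by simp
  \<comment> \<open>The Gaussian decreases in the modulus of its argument, so its value at the
    larger modulus of the two endpoints bounds it below on \<open>{x..<y}\<close>.\<close>
  define m where "m = ?f (max \<bar>x\<bar> \<bar>y\<bar>)"
  have "{x..} = {x..<y} \<union> {y..}" "{x..<y} \<inter> {y..} = {}"
    using assms by auto
  then have split: "(LBINT t:{x..}. ?f t) = (LBINT t:{x..<y}. ?f t) + (LBINT t:{y..}. ?f t)"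
    using set_integral_Un[of "{x..<y}" "{y..}" lborel ?f] si by simp
  have "(LBINT t:{x..<y}. m) \<le> (LBINT t:{x..<y}. ?f t)"
  proof (rule set_integral_mono)
    show "set_integrable lborel {x..<y} (\<lambda>t. m)"
      unfolding set_integrable_def using assms by (intro integrable_scaleR_left) auto
    show "set_integrable lborel {x..<y} ?f"
      by (rule si) simp
    fix t assume "t \<in> {x..<y}"
    then have "\<bar>t\<bar> \<le> \<bar>max \<bar>x\<bar> \<bar>y\<bar>\<bar>" by auto
    then have "t^2 \<le> (max \<bar>x\<bar> \<bar>y\<bar>)^2"
      by (simp only: abs_le_square_iff)
    then show "m \<le> ?f t"
      by (simp add: m_def)
  qed
  moreover have "(LBINT t:{x..<y}. m) = (y - x) * m"
    using assms by (simp add: set_lebesgue_integral_def)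
  moreover have "0 < (y - x) * m"
    using assms by (simp add: m_def)
  ultimately have "(LBINT t:{y..}. ?f t) < (LBINT t:{x..}. ?f t)"
    using split by linarith
  then show ?thesis
    unfolding Q_fun_def by (intro mult_strict_left_mono) auto
qed

text \<open>For nonnegative \<open>x\<close> and \<open>k\<close> this is Lagrange's identity, the
  exact defect in Cauchy-Schwarz, for the vectors \<open>(a * sqrt x, s * sqrt k)\<close> and
  \<open>(q * sqrt k, p * sqrt x)\<close>.\<close>

lemma snr_cost_gap:
  fixes a s p q k x :: real
  shows "(x * a^2 + k * s^2) * (q^2 * k + p^2 * x) - (s * p + a * q)^2 * (x * k)
    = (p * a * x - q * s * k)^2"
  by algebra

lemma snr_denominator_pos:
  fixes a s k x :: real
  assumes "0 < a" "0 < s" "0 \<le> k" "0 \<le> x" "k \<noteq> 0 \<or> x \<noteq> 0"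
  shows "0 < x * a^2 + k * s^2"
  using assms by (metis add_nonneg_pos add_pos_nonneg less_eq_real_def mult_nonneg_nonneg
      mult_pos_pos zero_le_power zero_less_power)

text \<open>Here \<open>c\<close> plays the SNR of one user, the first factor on the right its
  \<open>rho\<close>, and the last factor its cost. Dividing the gap identity by both positive
  denominators gives the bound; for \<open>k = x = 0\<close> both sides are 0.\<close>

lemma snr_le_cost:
  fixes a s p q k x c :: real
  assumes "0 < a" "0 < s" "0 < p" "0 < q" "0 \<le> k" "0 \<le> x"
  shows "x * k * c^2 * a^2 / (x * a^2 + k * s^2)
    \<le> c^2 * a^2 / (s * p + a * q)^2 * (q^2 * k + p^2 * x)"
proof (cases "k = 0 \<and> x = 0")
  case False
  let ?D = "x * a^2 + k * s^2" and ?C = "q^2 * k + p^2 * x" and ?R = "(s * p + a * q)^2"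
  have D: "0 < ?D" using assms False by (intro snr_denominator_pos) auto
  have "0 < s * p + a * q" using assms by (simp add: add_pos_pos)
  then have R: "0 < ?R" by simp
  have "?R * (x * k) \<le> ?D * ?C"
    using snr_cost_gap[of x a k s q p] zero_le_power2[of "p * a * x - q * s * k"] by linarith
  then have "(c^2 * a^2) * (?R * (x * k)) \<le> (c^2 * a^2) * (?D * ?C)"
    by (intro mult_left_mono) auto
  then have "x * k * c^2 * a^2 * ?R \<le> (c^2 * a^2 * ?C) * ?D"
    by (simp only: mult_ac)
  then have "x * k * c^2 * a^2 / ?D \<le> c^2 * a^2 * ?C / ?R"
    using D R by (simp only: divide_le_eq le_divide_eq times_divide_eq_left if_True if_False)
  then show ?thesis by simp
qed simp

text \<open>The manipulations behind the bound become equivalences, since \<open>c\<close> and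
  \<open>a\<close> are positive and \<open>c^2 * a^2\<close> cancels; equality then means that the
  square in the gap identity vanishes.\<close>

lemma snr_eq_cost_iff:
  fixes a s p q k x c :: real
  assumes "0 < a" "0 < s" "0 < p" "0 < q" "0 \<le> k" "0 \<le> x" "0 < c"
  shows "x * k * c^2 * a^2 / (x * a^2 + k * s^2)
      = c^2 * a^2 / (s * p + a * q)^2 * (q^2 * k + p^2 * x)
    \<longleftrightarrow> p * a * x = q * s * k"
proof (cases "k = 0 \<and> x = 0")
  case False
  let ?D = "x * a^2 + k * s^2" and ?C = "q^2 * k + p^2 * x" and ?R = "(s * p + a * q)^2"
  have D: "?D \<noteq> 0" using snr_denominator_pos[of a s k x] assms False by auto
  have "0 < s * p + a * q" using assms by (simp add: add_pos_pos)
  then have R: "?R \<noteq> 0" by simp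
  have "x * k * c^2 * a^2 / ?D = c^2 * a^2 / ?R * ?C
      \<longleftrightarrow> x * k * c^2 * a^2 / ?D = (c^2 * a^2 * ?C) / ?R"
    by simp
  also have "\<dots> \<longleftrightarrow> (x * k * c^2 * a^2) * ?R = (c^2 * a^2 * ?C) * ?D"
    by (rule frac_eq_eq[OF D R])
  also have "\<dots> \<longleftrightarrow> (c^2 * a^2) * (?R * (x * k)) = (c^2 * a^2) * (?D * ?C)"
    by (simp only: mult_ac)
  also have "\<dots> \<longleftrightarrow> ?R * (x * k) = ?D * ?C"
    using assms by simp
  also have "\<dots> \<longleftrightarrow> (p * a * x - q * s * k)^2 = 0"
    using snr_cost_gap[of x a k s q p] by linarith
  also have "\<dots> \<longleftrightarrow> p * a * x = q * s * k"
    by simp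
  finally show ?thesis .
qed simp

text \<open>The left side is a linear system in \<open>k\<close> and \<open>x\<close> whose
  determinant is, up to sign, \<open>p * q * (s * p + a * q)\<close>, hence nonzero. One direction
  verifies the claimed optimum, the other gives its uniqueness.\<close>

lemma balanced_budget_iff:
  fixes a s p q k x B :: real
  assumes "0 < a" "0 < s" "0 < p" "0 < q"
  shows "p * a * x = q * s * k \<and> q^2 * k + p^2 * x = B
    \<longleftrightarrow> k = a * B / (s * (p * q) + a * q^2) \<and> x = s * B / (s * p^2 + a * (p * q))"
    (is "?L \<longleftrightarrow> ?R")
proof -
  define D where "D = s * p + a * q"
  have D: "D > 0" using assms by (simp add: D_def add_pos_pos)
  have eq: "s * (p * q) + a * q^2 = q * D" "s * p^2 + a * (p * q) = p * D"
    by (simp_all add: D_def algebra_simps power2_eq_square)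
  show ?thesis
  proof
    assume L: ?L
    have "k * (q * D) = a * B" "x * (p * D) = s * B"
      using L unfolding D_def by algebra+
    then show ?R
      unfolding eq using assms D by (simp add: eq_divide_eq)
  next
    assume R: ?R
    have k: "k * q * D = a * B" and x: "x * p * D = s * B"
      using R assms D unfolding eq by simp_all
    have "(p * a * x) * D = (q * s * k) * D"
      using k x by algebra
    moreover have "(q^2 * k + p^2 * x) * D = (q * a + p * s) * B"
      using k x by algebra
    then have "(q^2 * k + p^2 * x) * D = B * D"
      by (simp add: D_def algebra_simps)
    ultimately show ?L
      using D by simp
  qed
qed

text \<open>Uniqueness is claimed only for a strict maximum at user 1: if another user ties for the
  largest \<open>rho\<close>, spending the whole balanced budget there is equally good.\<close>

theorem mainTheorem1:
  fixes n :: nat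
    and \<gamma> :: "nat \<Rightarrow> real"
    and h :: "nat \<Rightarrow> complex"
    and \<sigma>n \<sigma>v c0 Cbar :: real
  assumes "n \<ge> 1"
    and "\<And>i. i \<in> {1..n} \<Longrightarrow> \<gamma> i > 0"
    and "\<And>i. i \<in> {1..n} \<Longrightarrow> h i \<noteq> 0"
    and "\<sigma>n ^ 2 > 0" and "\<sigma>v ^ 2 > 0"
    and "c0 > 0" and "Cbar > 0"
    and "\<And>i. 1 \<le> i \<Longrightarrow> i < n \<Longrightarrow>
           rho \<gamma> h \<sigma>n \<sigma>v c0 i \<ge> rho \<gamma> h \<sigma>n \<sigma>v c0 (Suc i)"
  shows "optimal_solution n \<gamma> h \<sigma>n \<sigma>v c0 Cbar
           (kappa_opt n \<gamma> h \<sigma>n \<sigma>v c0 Cbar, gain_opt n \<gamma> h \<sigma>n \<sigma>v c0 Cbar) \<and>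
         ((\<forall>i\<in>{2..n}. rho \<gamma> h \<sigma>n \<sigma>v c0 i < rho \<gamma> h \<sigma>n \<sigma>v c0 1) \<longrightarrow>
           (\<forall>\<kappa> g. optimal_solution n \<gamma> h \<sigma>n \<sigma>v c0 Cbar (\<kappa>, g) \<longrightarrow>
             \<kappa> = kappa_opt n \<gamma> h \<sigma>n \<sigma>v c0 Cbar \<and> g = gain_opt n \<gamma> h \<sigma>n \<sigma>v c0 Cbar))"
proof -
  define s where "s = sigma_tilde \<sigma>n \<sigma>v"
  define q where "q = sqrt c0"
  define a where "a i = cmod (h i)" for i
  define p where "p i = sqrt (xi \<sigma>n \<gamma> i)" for i
  define r where "r = rho \<gamma> h \<sigma>n \<sigma>v c0"
  define T where "T k g i = (g i ^ 2 * k i * \<gamma> i ^ 2 * cmod (h i) ^ 2) /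
       (g i ^ 2 * cmod (h i) ^ 2 + k i * sigma_tilde \<sigma>n \<sigma>v ^ 2)" for k g :: "nat \<Rightarrow> real" and i
  define C where "C k g i = c0 * k i + xi \<sigma>n \<gamma> i * g i ^ 2" for k g :: "nat \<Rightarrow> real" and i
  define K where "K = kappa_opt n \<gamma> h \<sigma>n \<sigma>v c0 Cbar"
  define G where "G = gain_opt n \<gamma> h \<sigma>n \<sigma>v c0 Cbar"
  let ?F = "feasible n \<gamma> \<sigma>n c0 Cbar" and ?P = "error_prob n \<gamma> h \<sigma>n \<sigma>v"
  let ?S = "\<lambda>k g. \<Sum>i=1..n. T k g i"
  have "\<sigma>n \<noteq> 0" "\<sigma>v \<noteq> 0" using assms(4,5) by auto
  then have n4: "\<sigma>n ^ 4 > 0" and s: "s > 0"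
    by (simp_all add: s_def sigma_tilde_def)
  have q: "q > 0" "q^2 = c0" using assms(6) by (simp_all add: q_def)
  have a: "a i > 0" if "i \<in> {1..n}" for i using assms(3)[OF that] by (simp add: a_def)
  have xi: "xi \<sigma>n \<gamma> i > 0" if "i \<in> {1..n}" for i
    using assms(2)[OF that] n4 by (simp add: xi_def pi_one_def)
  have p: "p i > 0" "p i ^ 2 = xi \<sigma>n \<gamma> i" if "i \<in> {1..n}" for i
    using xi[OF that] by (simp_all add: p_def)
  have r: "r i = \<gamma> i ^ 2 * a i ^ 2 / (s * p i + a i * q)^2" for i
    by (simp add: r_def rho_def s_def p_def a_def q_def)
  have r_pos: "r i > 0" if "i \<in> {1..n}" for i
  proof -
    have "s * p i + a i * q > 0" using s p(1)[OF that] a[OF that] q by (simp add: add_pos_pos)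
    then show ?thesis using assms(2)[OF that] a[OF that] by (simp add: r)
  qed
  \<comment> \<open>The hypothesis compares neighbours only; induction upwards from 1 makes
    \<open>r 1\<close> the maximum.\<close>
  have r_le: "r i \<le> r 1" if "i \<in> {1..n}" for i
  proof -
    have "1 \<le> i" "i \<le> n" using that by auto
    then show ?thesis
    proof (induction i rule: dec_induct)
      case (step j)
      then show ?case using assms(8)[of j] by (simp add: r_def)
    qed simp
  qed
  have P: "?P k g = Q_fun (1/2 * sqrt (?S k g))" for k g
    by (simp add: error_prob_def T_def)
  have F: "?F (k, g) \<longleftrightarrow> (\<Sum>i=1..n. C k g i) \<le> Cbar \<and> k \<in> nonneg_vecs n \<and> g \<in> nonneg_vecs n"
    for k g by (simp add: feasible_def system_cost_def C_def)
  have nn: "v i \<ge> 0" if "v \<in> nonneg_vecs n" "i \<in> {1..n}" for v i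
    using that by (auto simp: nonneg_vecs_def PiE_def Pi_def)
  have T_le: "T k g i \<le> r i * C k g i" if "k \<in> nonneg_vecs n" "i \<in> {1..n}" for k g i
    using snr_le_cost[of "a i" s "p i" q "k i" "g i ^ 2" "\<gamma> i"] a[OF that(2)] s p[OF that(2)] q
      nn[OF that] by (simp add: T_def r C_def a_def s_def)
  have T_eq: "T k g i = r i * C k g i \<longleftrightarrow> p i * a i * g i ^ 2 = q * s * k i"
    if "k \<in> nonneg_vecs n" "i \<in> {1..n}" for k g i
    using snr_eq_cost_iff[of "a i" s "p i" q "k i" "g i ^ 2" "\<gamma> i"] a[OF that(2)] s p[OF that(2)] q
      nn[OF that] assms(2)[OF that(2)] by (simp add: T_def r C_def a_def s_def)
  have C_nn: "C k g i \<ge> 0" if "k \<in> nonneg_vecs n" "i \<in> {1..n}" for k g i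
    using nn[OF that] xi[OF that(2)] assms(6) by (simp add: C_def)
  have rC_le: "r i * C k g i \<le> r 1 * C k g i" if "k \<in> nonneg_vecs n" "i \<in> {1..n}" for k g i
    using r_le[OF that(2)] C_nn[OF that] by (intro mult_right_mono)
  have one: "1 \<in> {1..n}" using assms(1) by simp
  \<comment> \<open>Termwise chain
    \<open>T k g i \<le> r i * C k g i \<le> r 1 * C k g i\<close>.\<close>
  have S_le_C: "?S k g \<le> r 1 * (\<Sum>i=1..n. C k g i)" if "k \<in> nonneg_vecs n" for k g
    unfolding sum_distrib_left using T_le[OF that] rC_le[OF that]
    by (intro sum_mono) (meson order_trans)
  have S_le: "?S k g \<le> r 1 * Cbar" if "?F (k, g)" for k g
  proof -
    have "r 1 * (\<Sum>i=1..n. C k g i) \<le> r 1 * Cbar"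
      using that r_pos[OF one] by (intro mult_left_mono) (auto simp: F)
    then show ?thesis using S_le_C[of k g] that by (auto simp: F)
  qed
  have split1: "(\<Sum>i=1..n. f i) = f 1 + (\<Sum>i=2..n. f i)" for f :: "nat \<Rightarrow> real"
    using assms(1) by (simp add: sum.atLeast_Suc_atMost numeral_2_eq_2)
  have pq: "sqrt (xi \<sigma>n \<gamma> i * c0) = p i * q" for i
    by (simp add: p_def q_def real_sqrt_mult)
  have K1: "K 1 = a 1 * Cbar / (s * (p 1 * q) + a 1 * q^2)"
    using one q(2) by (simp add: K_def kappa_opt_def pq a_def s_def)
  have G1: "G 1 = sqrt (s * Cbar / (s * p 1 ^ 2 + a 1 * (p 1 * q)))"
    using one p(2)[OF one] by (simp add: G_def gain_opt_def pq a_def s_def)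
  have K0: "K i = 0" and G0: "G i = 0" if "i \<in> {2..n}" for i
    using that by (simp_all add: K_def G_def kappa_opt_def gain_opt_def)
  have ext: "v = w" if "v \<in> nonneg_vecs n" "w \<in> nonneg_vecs n" "v 1 = w 1"
    "\<And>i. i \<in> {2..n} \<Longrightarrow> v i = w i" for v w
  proof (rule PiE_ext)
    show "v \<in> {1..n} \<rightarrow>\<^sub>E {0..}" "w \<in> {1..n} \<rightarrow>\<^sub>E {0..}"
      using that by (simp_all add: nonneg_vecs_def)
    fix i assume "i \<in> {1..n}"
    then show "v i = w i" using that(3,4) by (cases "i = 1") auto
  qed
  \<comment> \<open>Nonnegativity of the radicand lets \<open>G 1 ^ 2\<close> recover it.\<close>
  have G1_arg: "s * Cbar / (s * p 1 ^ 2 + a 1 * (p 1 * q)) \<ge> 0"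
    using s p(1)[OF one] a[OF one] q(1) assms(7) by simp
  have opt: "p 1 * a 1 * G 1 ^ 2 = q * s * K 1 \<and> q^2 * K 1 + p 1 ^ 2 * G 1 ^ 2 = Cbar"
    unfolding balanced_budget_iff[OF a[OF one] s p(1)[OF one] q(1)]
    using K1 G1 G1_arg by simp
  have K_nn: "K \<in> nonneg_vecs n"
  proof -
    have "K 1 \<ge> 0" using K1 s p(1)[OF one] a[OF one] q(1) assms(7) by simp
    then show ?thesis
      by (auto simp: nonneg_vecs_def K_def kappa_opt_def split: if_splits)
  qed
  have G_nn: "G \<in> nonneg_vecs n"
  proof -
    have "G 1 \<ge> 0" using G1 G1_arg by simp
    then show ?thesis
      by (auto simp: nonneg_vecs_def G_def gain_opt_def split: if_splits)
  qed
  have C1: "C K G 1 = Cbar"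
    using opt q(2) p(2)[OF one] by (simp add: C_def)
  have FKG: "?F (K, G)"
    unfolding F split1 using C1 K_nn G_nn by (simp add: C_def K0 G0)
  \<comment> \<open>Balance at user 1 gives equality in its bound; every other summand is
    \<open>0 / 0 = 0\<close>.\<close>
  have SKG: "?S K G = r 1 * Cbar"
  proof -
    have "T K G 1 = r 1 * Cbar" using T_eq[OF K_nn one, of G] opt C1 by simp
    then show ?thesis unfolding split1 by (simp add: T_def K0 G0)
  qed
  have optimal: "optimal_solution n \<gamma> h \<sigma>n \<sigma>v c0 Cbar (K, G)"
    unfolding optimal_solution_def is_arg_min_def
  proof (intro conjI notI)
    show "?F (K, G)" by (rule FKG)
    assume "\<exists>y. ?F y \<and> (case y of (k, g) \<Rightarrow> ?P k g) < (case (K, G) of (k, g) \<Rightarrow> ?P k g)"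
    then obtain k g where kg: "?F (k, g)" "?P k g < ?P K G" by auto
    from S_le[OF kg(1)] have "1/2 * sqrt (?S k g) \<le> 1/2 * sqrt (?S K G)"
      unfolding SKG by simp
    then have "?P K G \<le> ?P k g"
      unfolding P using Q_fun_strict_antimono by (metis less_eq_real_def)
    with kg(2) show False by simp
  qed
  have unique: "k = K \<and> g = G"
    if strict: "\<forall>i\<in>{2..n}. r i < r 1" and o: "optimal_solution n \<gamma> h \<sigma>n \<sigma>v c0 Cbar (k, g)" for k g
  proof -
    have Fkg: "?F (k, g)" and min: "\<not> ?P K G < ?P k g"
      using o FKG unfolding optimal_solution_def is_arg_min_def by auto
    have k: "k \<in> nonneg_vecs n" and g: "g \<in> nonneg_vecs n"
      and cost: "(\<Sum>i=1..n. C k g i) \<le> Cbar"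
      using Fkg by (auto simp: F)
    \<comment> \<open>A smaller sum would give a strictly larger error, so any minimiser attains
      \<open>r 1 * Cbar\<close>, and every inequality leading to that bound must be tight.\<close>
    have "\<not> 1/2 * sqrt (?S k g) < 1/2 * sqrt (?S K G)"
      using min Q_fun_strict_antimono unfolding P by blast
    then have S: "?S k g = r 1 * Cbar"
      using S_le[OF Fkg] unfolding SKG by simp
    then have "r 1 * Cbar \<le> r 1 * (\<Sum>i=1..n. C k g i)"
      using S_le_C[OF k, of g] by simp
    then have total: "(\<Sum>i=1..n. C k g i) = Cbar"
      using cost r_pos[OF one] by simp
    have "(\<Sum>i=1..n. r 1 * C k g i - T k g i) = 0"
      using S total by (simp add: sum_subtractf sum_distrib_left[symmetric])
    moreover have "r 1 * C k g i - T k g i \<ge> 0" if "i \<in> {1..n}" for i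
      using T_le[OF k that, of g] rC_le[OF k that, of g] by simp
    ultimately have tight: "T k g i = r 1 * C k g i" if "i \<in> {1..n}" for i
      using that sum_nonneg_eq_0_iff[of "{1..n}" "\<lambda>i. r 1 * C k g i - T k g i"] by simp
    \<comment> \<open>Tightness gives \<open>r 1 * C k g i \<le> r i * C k g i\<close>; as
      \<open>r i < r 1\<close>, the nonnegative cost must vanish.\<close>
    have zero: "C k g i = 0" if "i \<in> {2..n}" for i
    proof -
      have i: "i \<in> {1..n}" using that by auto
      have "r 1 * C k g i \<le> r i * C k g i"
        using tight[OF i] T_le[OF k i, of g] by simp
      then show ?thesis
        using strict that C_nn[OF k i, of g] by (smt (verit) mult_less_cancel_right_pos)
    qed
    have zero': "k i = 0 \<and> g i = 0" if "i \<in> {2..n}" for i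
    proof -
      have i: "i \<in> {1..n}" using that by auto
      have "c0 * k i \<ge> 0" "xi \<sigma>n \<gamma> i * g i ^ 2 \<ge> 0"
        using nn[OF k i] xi[OF i] assms(6) by simp_all
      then have "c0 * k i = 0" "xi \<sigma>n \<gamma> i * g i ^ 2 = 0"
        using zero[OF that] unfolding C_def by linarith+
      then show ?thesis using xi[OF i] assms(6) by simp
    qed
    \<comment> \<open>User 1 now carries the whole budget with equality in its bound, so the linear
      system determines \<open>k 1\<close> and \<open>g 1 ^ 2\<close>.\<close>
    have "C k g 1 = Cbar" using total zero unfolding split1 by simp
    then have "p 1 * a 1 * g 1 ^ 2 = q * s * k 1 \<and> q^2 * k 1 + p 1 ^ 2 * g 1 ^ 2 = Cbar"
      using T_eq[OF k one, of g] tight[OF one] q(2) p(2)[OF one] by (simp add: C_def)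
    then have k1: "k 1 = K 1" and "g 1 ^ 2 = s * Cbar / (s * p 1 ^ 2 + a 1 * (p 1 * q))"
      unfolding balanced_budget_iff[OF a[OF one] s p(1)[OF one] q(1)] K1 by simp_all
    then have g1: "g 1 = G 1"
      using G1 nn[OF g one] by (metis real_sqrt_unique)
    show ?thesis
      using ext[OF k K_nn k1] ext[OF g G_nn g1] zero' K0 G0 by simp
  qed
  show ?thesis
    using optimal unique unfolding K_def G_def r_def by blast
qed

end
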